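(* There exist an absolute constant $c>0$ and, for every positive integer $s$, a constant $C_s>0$ such that the following holds for all positive integers $d,t$ and all integers $n\ge 3$. Let $\mathcal{H}$ be a set of $s$ half-spaces in $\mathbb{R}^d$, let $Q$ be a set of $n$ polytopes, each of which is an intersection of translates of elements of $\mathcal{H}$, and let $X$ be a set of $n$ points in $\mathbb{R}^d$. If the incidence graph $G$ of $X$ and $Q$ is $K_{t,t}$-free, then $G$ has at most $C_s\,t\,n(\log n)^{cd}$ edges.
   Context: The incidence graph of a set of points $X$ and a set $Q$ of subsets of $\mathbb{R}^d$ is the bipartite graph with vertex classes $X$ and $Q$ in which $x\in X$ and $q\in Q$ are adjacent if and only if $x\in q$. Polytopes here are intersections of finitely many half-spaces (not necessarily bounded). A graph is $K_{t,t}$-free if it has no subgraph isomorphic to the complete bipartite graph with both classes of size $t$. *)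

theory Defs
  imports Complex_Main "Jordan_Normal_Form.Matrix"
begin

text \<open>The dimension d is quantified underneath the existential quantifiers for the constants, so
  R^d is represented by the carrier \<^term>\<open>carrier_vec d :: real vec set\<close> and not by a type
  indexed by its dimension.\<close>

text \<open>Half-spaces may be open or closed; the reverse inequalities arise from the normal
  vector \<open>- a\<close>.\<close>

definition half_space :: "nat \<Rightarrow> real vec set \<Rightarrow> bool" where
  "half_space d h \<longleftrightarrow>
     (\<exists>a\<in>carrier_vec d. \<exists>b. a \<noteq> 0\<^sub>v d \<and>
        (h = {x \<in> carrier_vec d. a \<bullet> x \<le> b} \<or> h = {x \<in> carrier_vec d. a \<bullet> x < b}))"

text \<open>Intersections are taken inside R^d, so the intersection of the empty family is R^d.\<close>

definition inter_in :: "nat \<Rightarrow> real vec set set \<Rightarrow> real vec set" where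
  "inter_in d F = {x \<in> carrier_vec d. \<forall>h\<in>F. x \<in> h}"

definition polytope_in :: "nat \<Rightarrow> real vec set \<Rightarrow> bool" where
  "polytope_in d q \<longleftrightarrow> (\<exists>F. finite F \<and> (\<forall>h\<in>F. half_space d h) \<and> q = inter_in d F)"

definition translates :: "nat \<Rightarrow> real vec set set \<Rightarrow> real vec set set" where
  "translates d H = {(\<lambda>x. x + v) ` h | v h. v \<in> carrier_vec d \<and> h \<in> H}"

text \<open>A simple graph is a pair of a vertex set and a set of edges, each edge being a two-element
  set of vertices.\<close>

type_synonym 'a graph = "'a set \<times> 'a set set"

definition vertices :: "'a graph \<Rightarrow> 'a set" where
  "vertices G = fst G"

definition edges :: "'a graph \<Rightarrow> 'a set set" where
  "edges G = snd G"

definition simple_graph :: "'a graph \<Rightarrow> bool" where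
  "simple_graph G \<longleftrightarrow> (\<forall>e\<in>edges G. e \<subseteq> vertices G \<and> card e = 2)"

definition subgraph_of :: "'a graph \<Rightarrow> 'a graph \<Rightarrow> bool" where
  "subgraph_of S G \<longleftrightarrow> simple_graph S \<and> vertices S \<subseteq> vertices G \<and> edges S \<subseteq> edges G"

definition isomorphic_graphs :: "'a graph \<Rightarrow> 'b graph \<Rightarrow> bool" where
  "isomorphic_graphs G G' \<longleftrightarrow>
     (\<exists>f. bij_betw f (vertices G) (vertices G') \<and> edges G' = (\<lambda>e. f ` e) ` edges G)"

definition complete_bipartite :: "nat \<Rightarrow> nat \<Rightarrow> (nat + nat) graph" where
  "complete_bipartite m n =
     (Inl ` {..<m} \<union> Inr ` {..<n}, {{Inl i, Inr j} | i j. i < m \<and> j < n})"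

definition biclique_free :: "nat \<Rightarrow> 'a graph \<Rightarrow> bool" where
  "biclique_free t G \<longleftrightarrow>
     \<not> (\<exists>S. subgraph_of S G \<and> isomorphic_graphs S (complete_bipartite t t))"

text \<open>The sum type keeps the two vertex classes disjoint.\<close>

definition incidence_graph :: "'a set \<Rightarrow> 'a set set \<Rightarrow> ('a + 'a set) graph" where
  "incidence_graph X Q =
     (Inl ` X \<union> Inr ` Q, {{Inl x, Inr q} | x q. x \<in> X \<and> q \<in> Q \<and> x \<in> q})"

end

theory Submission imports Defs begin

text \<open>
  A polytope cut out by translates of s half-spaces is described by s thresholds, so incidence is
  dominance in R^s, and divide and conquer bounds the number of incidences with exponent s.
  If d < s, the exponent is reduced as follows: among the constraints in which the last coordinate
  has positive coefficient, select the one of least slack at the point, and likewise for negative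
  coefficients. The comparisons of slacks do not involve the last coordinate, so it is
  eliminated at the price of two dominance conditions and at most s^2 choices. After d steps only
  2d dominance conditions remain.
\<close>

section \<open>Dominance relations: divide and conquer\<close>

definition no_biclique :: "nat \<Rightarrow> ('a \<times> 'b) set \<Rightarrow> bool" where
  "no_biclique t E \<longleftrightarrow> \<not> (\<exists>A B. card A = t \<and> card B = t \<and> A \<times> B \<subseteq> E)"

lemma no_biclique_mono: "no_biclique t E \<Longrightarrow> E' \<subseteq> E \<Longrightarrow> no_biclique t E'"
  unfolding no_biclique_def by (metis order.trans)

definition dominance :: "'a set \<Rightarrow> 'b set \<Rightarrow> (('a \<Rightarrow> real) \<times> ('b \<Rightarrow> real)) list \<Rightarrow> ('a \<times> 'b) set" where
  "dominance X P fgs = {(x, p) \<in> X \<times> P. \<forall>(f, g)\<in>set fgs. f x \<le> g p}"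

text \<open>Used to cut \<open>X\<close> at the median of \<open>f\<close>. Points with equal values
  may fall on either side of the cut, so the size \<open>k\<close> can be prescribed
  exactly.\<close>

lemma initial_subset_exists:
  fixes f :: "'a \<Rightarrow> real"
  assumes "finite X" "k \<le> card X"
  shows "\<exists>A\<subseteq>X. card A = k \<and> (\<forall>x\<in>A. \<forall>y\<in>X - A. f x \<le> f y)"
  using assms(2)
proof (induction k)
  case 0
  show ?case by (intro exI[of _ "{}"]) auto
next
  case (Suc k)
  then obtain A where A: "A \<subseteq> X" "card A = k" "\<forall>x\<in>A. \<forall>y\<in>X - A. f x \<le> f y"
    by auto
  have "X - A \<noteq> {}"
    using A Suc.prems by (metis Diff_eq_empty_iff Suc_n_not_le_n card_mono assms(1) A finite_subset le_trans)
  then obtain z where z: "z \<in> X - A" "\<forall>y\<in>X - A. f z \<le> f y"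
    using ex_min_if_finite[of "f ` (X - A)"] assms(1) by (force simp: not_less)
  have "finite A"
    using A(1) assms(1) finite_subset by blast
  with A z show ?case
    by (intro exI[of _ "insert z A"]) auto
qed

text \<open>Nested induction on the conditions and on \<open>D\<close>. Cut \<open>X\<close> at the
  median of the first \<open>f\<close> into a lower part \<open>X1\<close> and an upper part
  \<open>X2\<close>; \<open>P2\<close> collects those \<open>p\<close> whose threshold is at least
  \<open>f\<close> on all of \<open>X1\<close>, and \<open>P1\<close> the rest. No pair in
  \<open>X2 \<times> P1\<close> qualifies, and on \<open>X1 \<times> P2\<close> the first condition
  holds automatically and is dropped. The two other products use disjoint parts of \<open>X\<close>
  and of \<open>P\<close>, so their bounds add up without loss.\<close>

lemma card_dominance_le:
  assumes "finite X" "finite P" "1 \<le> t" "card X \<le> 2 ^ D" "no_biclique t (dominance X P fgs)"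
  shows "card (dominance X P fgs) \<le> t * (card X + card P) * (D + 1) ^ length fgs"
  using assms
proof (induction fgs arbitrary: X P D)
  case Nil
  have E: "dominance X P [] = X \<times> P"
    by (auto simp: dominance_def)
  \<comment> \<open>Without conditions every pair is related, so a biclique is avoided only if one
    side has fewer than \<open>t\<close> elements.\<close>
  have "card X < t \<or> card P < t"
  proof (rule ccontr)
    assume "\<not> (card X < t \<or> card P < t)"
    then obtain A B where "A \<subseteq> X" "card A = t" "B \<subseteq> P" "card B = t"
      by (meson not_less obtain_subset_with_card_n)
    then show False
      using Nil.prems(5) unfolding E no_biclique_def by blast
  qed
  then have "card X * card P \<le> t * card P \<or> card X * card P \<le> t * card X"
    by (metis less_imp_le mult.commute mult_le_mono1)
  then have "card X * card P \<le> t * (card X + card P)"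
    unfolding distrib_left by linarith
  then show ?case
    by (simp add: E card_cartesian_product)
next
  case (Cons fg fgs)
  obtain f g where fg: "fg = (f, g)"
    by fastforce
  let ?m = "length fgs"
  show ?case
    using Cons.prems
  proof (induction D arbitrary: X P)
    case 0
    have "dominance X P (fg # fgs) \<subseteq> X \<times> P"
      by (auto simp: dominance_def)
    then have "card (dominance X P (fg # fgs)) \<le> card X * card P"
      by (metis 0(1,2) card_cartesian_product card_mono finite_cartesian_product)
    also have "\<dots> \<le> 1 * card P"
      using 0 by (intro mult_le_mono1) simp
    also have "\<dots> \<le> t * (card X + card P)"
      using \<open>1 \<le> t\<close> by (intro mult_le_mono) auto
    finally show ?case
      by simp
  next
    case (Suc D)
    obtain X1 where X1: "X1 \<subseteq> X" "card X1 = card X div 2" "\<forall>x\<in>X1. \<forall>y\<in>X - X1. f x \<le> f y"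
      using initial_subset_exists[OF \<open>finite X\<close>, of "card X div 2" f] by auto
    define X2 where "X2 = X - X1"
    define P2 where "P2 = {p \<in> P. \<forall>x\<in>X1. f x \<le> g p}"
    define P1 where "P1 = P - P2"
    have fin: "finite X1" "finite X2" "finite P1" "finite P2"
      using Suc.prems X1(1) by (auto simp: X2_def P1_def P2_def finite_subset)
    have cX: "card X1 + card X2 = card X" and cP: "card P1 + card P2 = card P"
      using Suc.prems X1(1) fin unfolding X2_def P1_def P2_def
      by (simp_all add: card_Diff_subset card_mono)
    \<comment> \<open>Rounding is harmless: as \<open>card X \<le> 2 * 2 ^ D\<close>, even the
      larger half has at most \<open>2 ^ D\<close> elements.\<close>
    have le: "card X1 \<le> 2 ^ D" "card X2 \<le> 2 ^ D"
      using X1(2) cX Suc.prems(4) by auto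
    let ?E = "dominance X P (fg # fgs)"
    let ?E1 = "dominance X1 P1 (fg # fgs)" and ?E2 = "dominance X2 P2 (fg # fgs)"
      and ?E3 = "dominance X1 P2 fgs"
    have split: "?E = ?E1 \<union> ?E2 \<union> ?E3"
    proof (intro equalityI subsetI)
      fix z assume z: "z \<in> ?E"
      obtain x p where xp: "z = (x, p)"
        by fastforce
      have "\<not> (x \<in> X2 \<and> p \<in> P1)"
      proof
        assume "x \<in> X2 \<and> p \<in> P1"
        then obtain y where "y \<in> X1" "g p < f y" "x \<in> X - X1"
          by (auto simp: P1_def P2_def X2_def not_le)
        moreover have "f x \<le> g p"
          using z by (auto simp: dominance_def xp fg)
        ultimately show False
          using X1(3) by force
      qed
      then show "z \<in> ?E1 \<union> ?E2 \<union> ?E3"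
        using z by (auto simp: dominance_def xp X2_def P1_def)
    qed (use X1(1) in \<open>auto simp: dominance_def X2_def P1_def P2_def fg\<close>)
    have free: "no_biclique t ?E1" "no_biclique t ?E2" "no_biclique t ?E3"
      using Suc.prems(5) split by (auto elim!: no_biclique_mono)
    have "card ?E1 \<le> t * (card X1 + card P1) * (D + 1) ^ Suc ?m"
      using Suc.IH[of X1 P1] fin le free \<open>1 \<le> t\<close> by simp
    moreover have "card ?E2 \<le> t * (card X2 + card P2) * (D + 1) ^ Suc ?m"
      using Suc.IH[of X2 P2] fin le free \<open>1 \<le> t\<close> by simp
    moreover have "card ?E3 \<le> t * (card X1 + card P2) * (D + 1) ^ ?m"
      using Cons.IH[of X1 P2 D] fin le free \<open>1 \<le> t\<close> by simp
    moreover have "t * (card X1 + card P2) * (D + 1) ^ ?m \<le> t * (card X + card P) * (D + 1) ^ ?m"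
      using cX cP by (intro mult_le_mono) auto
    moreover have "card ?E \<le> card ?E1 + card ?E2 + card ?E3"
      unfolding split by (meson add_le_mono1 card_Un_le le_trans)
    ultimately have "card ?E \<le> t * (card X1 + card P1) * (D + 1) ^ Suc ?m
        + t * (card X2 + card P2) * (D + 1) ^ Suc ?m + t * (card X + card P) * (D + 1) ^ ?m"
      by linarith
    \<comment> \<open>The two halves contribute \<open>(D + 1) ^ Suc ?m\<close> and the product with
      one condition fewer contributes \<open>(D + 1) ^ ?m\<close>, whence the factor
      \<open>D + 2\<close>.\<close>
    also have "\<dots> = t * (card X + card P) * ((D + 1) ^ ?m * (D + 2))"
      unfolding cX[symmetric] cP[symmetric] by (simp add: algebra_simps)
    also have "\<dots> \<le> t * (card X + card P) * (Suc D + 1) ^ length (fg # fgs)"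
    proof (intro mult_le_mono le_refl)
      have "(D + 1) ^ ?m * (D + 2) \<le> (D + 2) ^ ?m * (D + 2)"
        by (intro mult_le_mono1 power_mono) auto
      then show "(D + 1) ^ ?m * (D + 2) \<le> (Suc D + 1) ^ length (fg # fgs)"
        by (simp add: mult.commute)
    qed
    finally show ?case .
  qed
qed

section \<open>Elimination of coordinates\<close>

text \<open>An intermediate state of the elimination: \<open>fgs\<close> holds the conditions
  already turned into dominance, \<open>I\<close> indexes the linear constraints on the coordinates
  that remain. The functions in \<open>fgs\<close> may still depend on eliminated
  coordinates.\<close>

definition linear_dominance ::
  "'a set \<Rightarrow> 'b set \<Rightarrow> (('a \<Rightarrow> real) \<times> ('b \<Rightarrow> real)) list \<Rightarrow> ('a \<Rightarrow> nat \<Rightarrow> real) \<Rightarrow> nat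
    \<Rightarrow> 'i set \<Rightarrow> ('i \<Rightarrow> nat \<Rightarrow> real) \<Rightarrow> ('i \<Rightarrow> 'b \<Rightarrow> real) \<Rightarrow> ('a \<times> 'b) set" where
  "linear_dominance X P fgs \<xi> d I a b =
     {(x, p) \<in> dominance X P fgs. \<forall>k\<in>I. (\<Sum>j<d. a k j * \<xi> x j) \<le> b k p}"

text \<open>Eliminating one coordinate covers the relation by at most \<open>card I ^ 2\<close>
  relations of the same kind over the same \<open>I\<close>, with two more dominance conditions
  each. They are contained in the original relation, so they inherit the absence of bicliques. When
  no coordinate is left, \<open>card_dominance_le\<close> applies.\<close>

lemma card_linear_dominance_le:
  fixes a :: "'i \<Rightarrow> nat \<Rightarrow> real"
  assumes fin: "finite X" "finite P" "finite I" and I: "I \<noteq> {}"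
    and t: "1 \<le> t" and D: "card X \<le> 2 ^ D"
    and "no_biclique t (linear_dominance X P fgs \<xi> d I a b)"
  shows "card (linear_dominance X P fgs \<xi> d I a b)
    \<le> card I ^ (2 * d) * (t * (card X + card P) * (D + 1) ^ (length fgs + 2 * d))"
  using assms(7)
proof (induction d arbitrary: fgs a b)
  case 0
  \<comment> \<open>The sums are empty here, so the linear constraints restrict only
    \<open>P\<close>.\<close>
  define P' where "P' = {p \<in> P. \<forall>k\<in>I. 0 \<le> b k p}"
  have E: "linear_dominance X P fgs \<xi> 0 I a b = dominance X P' fgs"
    by (auto simp: linear_dominance_def dominance_def P'_def)
  have "finite P'" "card P' \<le> card P"
    using fin(2) by (auto simp: P'_def intro: card_mono)
  then have "card (dominance X P' fgs) \<le> t * (card X + card P') * (D + 1) ^ length fgs"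
    using card_dominance_le[of X P' t D fgs] fin t D 0 unfolding E by simp
  also have "\<dots> \<le> t * (card X + card P) * (D + 1) ^ length fgs"
    using \<open>card P' \<le> card P\<close> by (intro mult_le_mono) auto
  finally show ?case
    by (simp add: E)
next
  case (Suc d)
  let ?E = "linear_dominance X P fgs \<xi> (Suc d) I a b"
  define U where "U = {k \<in> I. a k d > 0}"
  define L where "L = {k \<in> I. a k d < 0}"
  \<comment> \<open>If no constraint has the given sign, an arbitrary index serves as a harmless choice.\<close>
  define S where "S = (\<lambda>V::'i set. if V = {} then I else V)"
  define \<phi> where "\<phi> = (\<lambda>k x. \<Sum>j<Suc d. a k j * \<xi> x j)"
  \<comment> \<open>The division makes the coefficient of the last coordinate 1 or -1 in every
    constraint where it occurs; among constraints of equal sign it then disappears from differences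
    of slacks.\<close>
  define slack where "slack = (\<lambda>k x p. (b k p - \<phi> k x) / \<bar>a k d\<bar>)"
  \<comment> \<open>Together with \<open>b'\<close> this encodes that the selected constraint
    \<open>e\<close> has at most the slack of \<open>k\<close>; for \<open>k = e\<close> it reads
    \<open>0 \<le> 0\<close>. Constraints without the last coordinate are kept.\<close>
  define a' where "a' = (\<lambda>i j k l. if a k d = 0 then a k l else
    let e = if a k d > 0 then i else j in a k l / \<bar>a k d\<bar> - a e l / \<bar>a e d\<bar>)"
  define b' where "b' = (\<lambda>i j k p. if a k d = 0 then b k p else
    let e = if a k d > 0 then i else j in b k p / \<bar>a k d\<bar> - b e p / \<bar>a e d\<bar>)"
  \<comment> \<open>The selected constraints still involve the last coordinate, which does no harm
    in a dominance condition.\<close>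
  define fgs' where "fgs' = (\<lambda>i j. (\<phi> i, b i) # (\<phi> j, b j) # fgs)"
  define E' where "E' = (\<lambda>(i, j). linear_dominance X P (fgs' i j) \<xi> d I (a' i j) (b' i j))"
  have S_sub: "S U \<subseteq> I" "S L \<subseteq> I" "U \<subseteq> I" "L \<subseteq> I"
    by (auto simp: S_def U_def L_def)
  have S_pos: "a i d > 0" if "k \<in> I" "a k d > 0" "i \<in> S U" for i k
    using that by (auto simp: S_def U_def split: if_splits)
  have S_neg: "a j d < 0" if "k \<in> I" "a k d < 0" "j \<in> S L" for j k
    using that by (auto simp: S_def L_def split: if_splits)
  have \<phi>: "\<phi> k x = (\<Sum>l<d. a k l * \<xi> x l) + a k d * \<xi> x d" for k x
    by (simp add: \<phi>_def)
  have elim: "(\<Sum>l<d. a' i j k l * \<xi> x l) \<le> b' i j k p \<longleftrightarrow>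
      (if a k d = 0 then \<phi> k x \<le> b k p
       else slack (if a k d > 0 then i else j) x p \<le> slack k x p)"
    if ij: "i \<in> S U" "j \<in> S L" "k \<in> I" for i j k x p
  proof (cases "a k d = 0")
    case True
    then show ?thesis
      by (simp add: a'_def b'_def \<phi>)
  next
    case False
    define e where "e = (if a k d > 0 then i else j)"
    have sgn: "a k d > 0 \<and> a e d > 0 \<or> a k d < 0 \<and> a e d < 0"
      using S_pos[of k i] S_neg[of k j] ij False by (auto simp: e_def not_less order_less_le)
    have "(\<Sum>l<d. a' i j k l * \<xi> x l)
        = (\<Sum>l<d. a k l * \<xi> x l) / \<bar>a k d\<bar> - (\<Sum>l<d. a e l * \<xi> x l) / \<bar>a e d\<bar>"
      using False by (simp add: a'_def e_def[symmetric] Let_def sum_subtractf sum_divide_distrib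
          algebra_simps)
    \<comment> \<open>By equality of signs, \<open>a k d / \<bar>a k d\<bar>\<close> and
      \<open>a e d / \<bar>a e d\<bar>\<close> coincide, so the terms in \<open>\<xi> x d\<close>
      cancel.\<close>
    also have "\<dots> = \<phi> k x / \<bar>a k d\<bar> - \<phi> e x / \<bar>a e d\<bar>"
      using sgn by (auto simp: \<phi> add_divide_distrib)
    finally show ?thesis
      using False by (auto simp: b'_def e_def[symmetric] Let_def slack_def diff_divide_distrib)
  qed
  have slack_iff: "0 \<le> slack k x p \<longleftrightarrow> \<phi> k x \<le> b k p" if "a k d \<noteq> 0" for k x p
    using that by (auto simp: slack_def zero_le_divide_iff)
  \<comment> \<open>If the selected constraints hold, their slacks are nonnegative, and so are the
    slacks that are at least as large.\<close>
  have sub: "E' ij \<subseteq> ?E" if ij: "ij \<in> S U \<times> S L" for ij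
  proof
    fix z assume z: "z \<in> E' ij"
    obtain i j x p where eq: "z = (x, p)" "ij = (i, j)"
      by fastforce
    have dom: "(x, p) \<in> dominance X P fgs" "\<phi> i x \<le> b i p" "\<phi> j x \<le> b j p"
      using z by (auto simp: E'_def eq linear_dominance_def dominance_def fgs'_def)
    have "\<phi> k x \<le> b k p" if k: "k \<in> I" for k
    proof (cases "a k d = 0")
      case True
      then show ?thesis
        using z elim[of i j k x p] ij k by (auto simp: E'_def eq linear_dominance_def)
    next
      case False
      define e where "e = (if a k d > 0 then i else j)"
      have "slack e x p \<le> slack k x p"
        using z elim[of i j k x p] ij k False
        unfolding e_def by (auto simp: E'_def eq linear_dominance_def)
      moreover have "a e d \<noteq> 0"
        using S_pos[of k i] S_neg[of k j] ij k False by (auto simp: e_def eq not_less order_less_le)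
      then have "0 \<le> slack e x p"
        using dom slack_iff by (simp add: e_def)
      ultimately show ?thesis
        using slack_iff[OF False, of x p] by linarith
    qed
    then show "z \<in> ?E"
      using dom(1) by (simp add: linear_dominance_def eq \<phi>_def)
  qed
  have minS: "\<exists>i\<in>S V. \<forall>k\<in>V. slack i x p \<le> slack k x p" if "V \<subseteq> I" for V x p
  proof (cases "V = {}")
    case True
    then show ?thesis
      using I by (auto simp: S_def)
  next
    case False
    have "finite V"
      using that fin(3) finite_subset by blast
    then obtain i where "i \<in> V" "\<forall>k\<in>V. slack i x p \<le> slack k x p"
      using ex_min_if_finite[of "(\<lambda>k. slack k x p) ` V"] False by (force simp: not_less)
    then show ?thesis
      using False by (auto simp: S_def)
  qed
  \<comment> \<open>The minimising indices depend on the pair \<open>(x, p)\<close>, which is why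
    all choices \<open>(i, j)\<close> must be united.\<close>
  have cover: "?E \<subseteq> (\<Union>ij\<in>S U \<times> S L. E' ij)"
  proof
    fix z assume z: "z \<in> ?E"
    obtain x p where eq: "z = (x, p)"
      by fastforce
    have \<phi>_le: "\<phi> k x \<le> b k p" if "k \<in> I" for k
      using z that by (simp add: linear_dominance_def eq \<phi>_def)
    obtain i where i: "i \<in> S U" "\<forall>k\<in>U. slack i x p \<le> slack k x p"
      using minS[of U] S_sub by blast
    obtain j where j: "j \<in> S L" "\<forall>k\<in>L. slack j x p \<le> slack k x p"
      using minS[of L] S_sub by blast
    have "(\<Sum>l<d. a' i j k l * \<xi> x l) \<le> b' i j k p" if k: "k \<in> I" for k
      using elim[OF i(1) j(1) k, of x p] \<phi>_le[OF k] i(2) j(2) k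
      by (auto simp: U_def L_def)
    moreover have "\<phi> i x \<le> b i p" "\<phi> j x \<le> b j p"
      using \<phi>_le i(1) j(1) S_sub by auto
    ultimately have "z \<in> E' (i, j)"
      using z by (auto simp: E'_def linear_dominance_def dominance_def fgs'_def eq)
    then show "z \<in> (\<Union>ij\<in>S U \<times> S L. E' ij)"
      using i(1) j(1) by blast
  qed
  \<comment> \<open>The exponent arises as \<open>(length fgs + 2) + 2 * d\<close>, because
    \<open>fgs'\<close> is longer than \<open>fgs\<close> by two.\<close>
  let ?B = "t * (card X + card P) * (D + 1) ^ (length fgs + 2 * Suc d)"
  have bound: "card (E' ij) \<le> card I ^ (2 * d) * ?B" if ij: "ij \<in> S U \<times> S L" for ij
  proof -
    obtain i j where eq: "ij = (i, j)"
      by fastforce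
    have "no_biclique t (E' ij)"
      using no_biclique_mono[OF Suc.prems sub[OF ij]] .
    then show ?thesis
      using Suc.IH[of "fgs' i j" "a' i j" "b' i j"] by (simp add: E'_def eq fgs'_def)
  qed
  have finE: "finite (E' ij)" for ij
  proof (rule finite_subset)
    show "E' ij \<subseteq> X \<times> P"
      by (auto simp: E'_def linear_dominance_def dominance_def split: prod.splits)
  qed (use fin in simp)
  have finS: "finite (S U \<times> S L)"
    using S_sub fin(3) by (meson finite_SigmaI finite_subset)
  have "card ?E \<le> card (\<Union>ij\<in>S U \<times> S L. E' ij)"
    using cover finE finS by (intro card_mono) auto
  also have "\<dots> \<le> (\<Sum>ij\<in>S U \<times> S L. card (E' ij))"
    by (rule card_UN_le[OF finS])
  also have "\<dots> \<le> card (S U \<times> S L) * (card I ^ (2 * d) * ?B)"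
    using sum_bounded_above[of "S U \<times> S L" "\<lambda>ij. card (E' ij)"] bound by simp
  also have "\<dots> \<le> (card I * card I) * (card I ^ (2 * d) * ?B)"
    unfolding card_cartesian_product using S_sub fin(3)
    by (intro mult_le_mono card_mono) auto
  also have "\<dots> = card I ^ (2 * Suc d) * ?B"
    by (simp add: algebra_simps)
  finally show ?case .
qed

section \<open>Polytopes as systems of thresholds\<close>

text \<open>On a finite set, a strict bound or the conjunction of infinitely many bounds amounts to
  one closed bound, namely the largest value of \<open>f\<close> on \<open>T\<close>. This treats
  open and closed half-spaces alike.\<close>

lemma finite_down_closed_threshold:
  fixes f :: "'a \<Rightarrow> real"
  assumes "finite X" "T \<subseteq> X" and down: "\<And>x y. x \<in> X \<Longrightarrow> y \<in> T \<Longrightarrow> f x \<le> f y \<Longrightarrow> x \<in> T"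
  shows "\<exists>\<beta>. \<forall>x\<in>X. x \<in> T \<longleftrightarrow> f x \<le> \<beta>"
proof (cases "T = {}")
  case True
  obtain \<beta> where "\<forall>x\<in>X. \<beta> \<le> f x"
    using bdd_below_finite[of "f ` X"] assms(1) by (force simp: bdd_below_def)
  with True show ?thesis
    \<comment> \<open>For empty \<open>T\<close> the threshold must lie strictly below all values of
      \<open>f\<close>.\<close>
    by (intro exI[of _ "\<beta> - 1"]) force
next
  case False
  have "finite T"
    using assms finite_subset by blast
  then have "Max (f ` T) \<in> f ` T" "\<forall>x\<in>T. f x \<le> Max (f ` T)"
    using False by simp_all
  then obtain y where "y \<in> T" "\<forall>x\<in>T. f x \<le> f y"
    by auto
  then show ?thesis
    using down by (intro exI[of _ "f y"]) blast
qed

text \<open>Translation by \<open>v\<close> shifts the functional by the constant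
  \<open>a \<bullet> v\<close>, so all translates of \<open>h\<close> are lower sets of the same
  functional.\<close>

lemma half_space_translate_down_closed:
  assumes h: "h = {x \<in> carrier_vec d. a \<bullet> x \<le> b} \<or> h = {x \<in> carrier_vec d. a \<bullet> x < (b::real)}"
    and a: "a \<in> carrier_vec d" and v: "v \<in> carrier_vec d"
    and x: "x \<in> carrier_vec d" and y: "y \<in> (\<lambda>x. x + v) ` h" and le: "a \<bullet> x \<le> a \<bullet> y"
  shows "x \<in> (\<lambda>x. x + v) ` h"
proof -
  obtain z where z: "z \<in> h" "y = z + v"
    using y by blast
  have zc: "z \<in> carrier_vec d"
    using h z by auto
  have "a \<bullet> (x - v) = a \<bullet> x - a \<bullet> v" "a \<bullet> y = a \<bullet> z + a \<bullet> v"
    using a v x zc z(2) by (simp_all add: scalar_prod_minus_distrib scalar_prod_add_distrib)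
  then have "a \<bullet> (x - v) \<le> a \<bullet> z"
    using le by simp
  then have "x - v \<in> h"
    using h z(1) x v by auto
  moreover have "x = (x - v) + v"
    using x v by (intro eq_vecI) auto
  ultimately show ?thesis
    by (rule rev_image_eqI)
qed

text \<open>The translates of one \<open>h\<close> used by \<open>q\<close> are lower sets of a
  common functional, and so is their intersection. On the finite set \<open>X\<close> it is
  therefore a single inequality, however many translates cut out \<open>q\<close>.\<close>

lemma polytope_thresholds:
  assumes X: "finite X" "X \<subseteq> carrier_vec d" and H: "\<And>h. h \<in> H \<Longrightarrow> half_space d h"
    and F: "\<And>q. q \<in> Q \<Longrightarrow> \<exists>F\<subseteq>translates d H. q = inter_in d F"
  shows "\<exists>a b. (\<forall>h\<in>H. a h \<in> carrier_vec d)
    \<and> (\<forall>x\<in>X. \<forall>q\<in>Q. x \<in> q \<longleftrightarrow> (\<forall>h\<in>H. a h \<bullet> x \<le> (b h q :: real)))"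
proof -
  have "\<forall>h\<in>H. \<exists>a. a \<in> carrier_vec d \<and>
      (\<exists>c. h = {x \<in> carrier_vec d. a \<bullet> x \<le> c} \<or> h = {x \<in> carrier_vec d. a \<bullet> x < c})"
    using H unfolding half_space_def by blast
  then obtain a where a': "\<forall>h\<in>H. a h \<in> carrier_vec d \<and>
      (\<exists>c. h = {x \<in> carrier_vec d. a h \<bullet> x \<le> c} \<or> h = {x \<in> carrier_vec d. a h \<bullet> x < c})"
    by (rule bchoice[THEN exE])
  have "\<forall>q\<in>Q. \<exists>F. F \<subseteq> translates d H \<and> q = inter_in d F"
    using F by blast
  then obtain F where F': "\<forall>q\<in>Q. F q \<subseteq> translates d H \<and> q = inter_in d (F q)"
    by (rule bchoice[THEN exE])
  \<comment> \<open>The trace on \<open>X\<close> of all translates of \<open>h\<close> in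
    \<open>F q\<close>; it is all of \<open>X\<close> if there are none.\<close>
  define T where "T = (\<lambda>h q. {x \<in> X. \<forall>v\<in>carrier_vec d.
    (\<lambda>x. x + v) ` h \<in> F q \<longrightarrow> x \<in> (\<lambda>x. x + v) ` h})"
  have "\<exists>\<beta>. \<forall>x\<in>X. x \<in> T h q \<longleftrightarrow> a h \<bullet> x \<le> \<beta>" if h: "h \<in> H" for h q
  proof (rule finite_down_closed_threshold[OF X(1)])
    show "T h q \<subseteq> X"
      by (auto simp: T_def)
    fix x y assume x: "x \<in> X" and y: "y \<in> T h q" and le: "a h \<bullet> x \<le> a h \<bullet> y"
    obtain c where c: "h = {x \<in> carrier_vec d. a h \<bullet> x \<le> c} \<or> h = {x \<in> carrier_vec d. a h \<bullet> x < c}"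
      and ah: "a h \<in> carrier_vec d"
      using a' h by blast
    have "x \<in> (\<lambda>x. x + v) ` h" if "v \<in> carrier_vec d" "(\<lambda>x. x + v) ` h \<in> F q" for v
    proof (rule half_space_translate_down_closed[OF c ah that(1) _ _ le])
      show "x \<in> carrier_vec d"
        using x X(2) by blast
      show "y \<in> (\<lambda>x. x + v) ` h"
        using y that unfolding T_def by blast
    qed
    then show "x \<in> T h q"
      using x unfolding T_def by blast
  qed
  then have "\<forall>h\<in>H. \<exists>\<beta>. \<forall>q. \<forall>x\<in>X. x \<in> T h q \<longleftrightarrow> a h \<bullet> x \<le> \<beta> q"
    by (intro ballI choice allI)
  then obtain b where b: "\<forall>h\<in>H. \<forall>q. \<forall>x\<in>X. x \<in> T h q \<longleftrightarrow> a h \<bullet> x \<le> b h q"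
    by (rule bchoice[THEN exE])
  have T_iff: "x \<in> q \<longleftrightarrow> (\<forall>h\<in>H. x \<in> T h q)" if x: "x \<in> X" and q: "q \<in> Q" for x q
  proof -
    have F: "F q \<subseteq> translates d H" "q = inter_in d (F q)"
      using F' q by auto
    have "x \<in> q \<longleftrightarrow> (\<forall>g\<in>F q. x \<in> g)"
      by (subst F(2)) (use x X(2) in \<open>auto simp: inter_in_def\<close>)
    also have "\<dots> \<longleftrightarrow> (\<forall>h\<in>H. x \<in> T h q)"
    proof
      assume r: "\<forall>h\<in>H. x \<in> T h q"
      show "\<forall>g\<in>F q. x \<in> g"
      proof
        fix g assume g: "g \<in> F q"
        then obtain v h where "v \<in> carrier_vec d" "h \<in> H" "g = (\<lambda>x. x + v) ` h"
          using F(1) unfolding translates_def by blast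
        then show "x \<in> g"
          using r g by (simp add: T_def)
      qed
    qed (use x in \<open>simp add: T_def\<close>)
    finally show ?thesis .
  qed
  show ?thesis
  proof (intro exI[of _ a] exI[of _ b] conjI ballI)
    show "a h \<in> carrier_vec d" if "h \<in> H" for h
      using a' that by blast
    show "x \<in> q \<longleftrightarrow> (\<forall>h\<in>H. a h \<bullet> x \<le> b h q)" if "x \<in> X" "q \<in> Q" for x q
      using T_iff[OF that] b that(1) by simp
  qed
qed

section \<open>Passage to the incidence graph\<close>

lemma no_biclique_incidences:
  assumes "biclique_free t (incidence_graph X Q)" and t: "1 \<le> t"
  shows "no_biclique t {(x, q) \<in> X \<times> Q. x \<in> q}"
  unfolding no_biclique_def
proof (rule notI, elim exE conjE)
  fix A B
  assume A: "card A = t" and B: "card B = t" and sub: "A \<times> B \<subseteq> {(x, q) \<in> X \<times> Q. x \<in> q}"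
  \<comment> \<open>Positivity of \<open>t\<close> enters here: \<open>card A = t\<close> then
    forces \<open>A\<close> to be finite and nonempty. Nonemptiness of each factor is what lets the
    other be located inside \<open>X\<close> or \<open>Q\<close>.\<close>
  have fin: "finite A" "finite B" and ne: "A \<noteq> {}" "B \<noteq> {}"
    using A B t by (auto intro: card_ge_0_finite)
  obtain u where u: "bij_betw u A {0..<card A}"
    using ex_bij_betw_finite_nat[OF fin(1)] by blast
  obtain v where v: "bij_betw v B {0..<card B}"
    using ex_bij_betw_finite_nat[OF fin(2)] by blast
  have uv: "u ` A = {..<t}" "v ` B = {..<t}" "inj_on u A" "inj_on v B"
    using u v A B by (simp_all add: bij_betw_def atLeast0LessThan)
  have incident: "x \<in> X \<and> q \<in> Q \<and> x \<in> q" if "x \<in> A" "q \<in> B" for x q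
    using sub that by blast
  then have AB: "A \<subseteq> X" "B \<subseteq> Q"
    using ne by blast+
  define S where "S = (Inl ` A \<union> Inr ` B, {{Inl x, Inr q} | x q. x \<in> A \<and> q \<in> B})"
  have S: "vertices S = Inl ` A \<union> Inr ` B" "edges S = {{Inl x, Inr q} | x q. x \<in> A \<and> q \<in> B}"
    by (simp_all add: S_def vertices_def edges_def)
  have "simple_graph S"
    unfolding simple_graph_def S by auto
  moreover have "vertices S \<subseteq> vertices (incidence_graph X Q)"
    unfolding S using AB by (auto simp: vertices_def incidence_graph_def)
  moreover have "edges S \<subseteq> edges (incidence_graph X Q)"
    unfolding S using incident by (auto simp: edges_def incidence_graph_def)
  ultimately have "subgraph_of S (incidence_graph X Q)"
    by (simp add: subgraph_of_def)
  moreover have "isomorphic_graphs S (complete_bipartite t t)"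
    unfolding isomorphic_graphs_def
  proof (intro exI[of _ "map_sum u v"] conjI)
    have "inj_on (map_sum u v) (Inl ` A \<union> Inr ` B)"
      by (rule inj_onI) (auto dest: inj_onD[OF uv(3)] inj_onD[OF uv(4)])
    moreover have "map_sum u v ` (Inl ` A \<union> Inr ` B) = Inl ` u ` A \<union> Inr ` v ` B"
      by (simp add: image_Un image_image)
    moreover have "vertices (complete_bipartite t t) = Inl ` u ` A \<union> Inr ` v ` B"
      unfolding uv by (simp add: complete_bipartite_def vertices_def)
    ultimately show "bij_betw (map_sum u v) (vertices S) (vertices (complete_bipartite t t))"
      unfolding bij_betw_def S by metis
    have "edges (complete_bipartite t t) = {{Inl i, Inr j} | i j. i \<in> u ` A \<and> j \<in> v ` B}"
      unfolding uv by (simp add: edges_def complete_bipartite_def)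
    also have "\<dots> = (\<lambda>e. map_sum u v ` e) ` edges S"
    proof (intro equalityI subsetI)
      fix e :: "(nat + nat) set"
      assume "e \<in> {{Inl i, Inr j} | i j. i \<in> u ` A \<and> j \<in> v ` B}"
      then obtain x q where "x \<in> A" "q \<in> B" "e = map_sum u v ` {Inl x, Inr q}"
        by auto
      then show "e \<in> (\<lambda>e. map_sum u v ` e) ` edges S"
        unfolding S by blast
    next
      fix e assume "e \<in> (\<lambda>e. map_sum u v ` e) ` edges S"
      then obtain x q where "x \<in> A" "q \<in> B" "e = {Inl (u x), Inr (v q)}"
        unfolding S by auto
      then show "e \<in> {{Inl i, Inr j} | i j. i \<in> u ` A \<and> j \<in> v ` B}"
        by blast
    qed
    finally show "edges (complete_bipartite t t) = (\<lambda>e. map_sum u v ` e) ` edges S" .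
  qed
  ultimately show False
    using assms(1) unfolding biclique_free_def by blast
qed

lemma card_edges_incidence_graph:
  "card (edges (incidence_graph X Q)) = card {(x, q) \<in> X \<times> Q. x \<in> q}"
proof -
  have "edges (incidence_graph X Q) = (\<lambda>(x, q). {Inl x, Inr q}) ` {(x, q) \<in> X \<times> Q. x \<in> q}"
    by (auto simp: edges_def incidence_graph_def)
  moreover have "inj_on (\<lambda>(x, q). {Inl x, Inr q}) {(x, q) \<in> X \<times> Q. x \<in> q}"
    by (auto simp: inj_on_def doubleton_eq_iff)
  ultimately show ?thesis
    by (simp add: card_image)
qed

section \<open>Logarithms and the final bound\<close>

lemma ln_ge_one: "1 \<le> ln (real n)" if "3 \<le> n"
  using exp_le that by (subst ln_ge_iff) auto

text \<open>\<open>D\<close> is the binary logarithm of \<open>n\<close> rounded up. That logarithm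
  is at most \<open>2 * ln n\<close>, and rounding and the summand 1 add at most
  \<open>2 \<le> 2 * ln n\<close>.\<close>

lemma dyadic_exponent:
  assumes "3 \<le> n"
  shows "\<exists>D. n \<le> 2 ^ D \<and> real (D + 1) \<le> 4 * ln (real n)"
proof (intro exI conjI)
  let ?D = "nat \<lceil>log 2 (real n)\<rceil>"
  have "0 \<le> log 2 (real n)"
    using assms by simp
  have "real n = 2 powr log 2 (real n)"
    using assms by simp
  also have "\<dots> \<le> 2 powr real ?D"
    by (intro powr_mono) linarith+
  finally have "real n \<le> real (2 ^ ?D)"
    by (simp add: powr_realpow)
  then show "n \<le> 2 ^ ?D"
    by linarith
  have "log 2 (real n) \<le> 2 * ln (real n)"
  proof -
    \<comment> \<open>This is \<open>1 \<le> ln 4\<close>.\<close>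
    have "1 \<le> 2 * ln (2::real)"
      using ln_ge_one[of 4] ln_realpow[of "2::real" 2] by simp
    then have "ln (real n) * 1 \<le> ln (real n) * (2 * ln 2)"
      using ln_ge_one[OF assms] by (intro mult_left_mono) auto
    then show ?thesis
      by (simp add: log_def field_simps)
  qed
  moreover have "real ?D \<le> log 2 (real n) + 1"
    using \<open>0 \<le> log 2 (real n)\<close> by linarith
  ultimately show "real (?D + 1) \<le> 4 * ln (real n)"
    using ln_ge_one[OF assms] by simp
qed

text \<open>Coordinates are eliminated only if \<open>d < card H\<close>, so the number of choices
  is bounded in terms of \<open>card H\<close> alone. Otherwise the thresholds already form
  \<open>card H \<le> d\<close> dominance conditions.\<close>

lemma card_incidences_le:
  assumes t: "1 \<le> t"
    and H: "finite H" "H \<noteq> {}" "\<And>h. h \<in> H \<Longrightarrow> half_space d h"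
    and Q: "finite Q" "\<And>q. q \<in> Q \<Longrightarrow> \<exists>F\<subseteq>translates d H. q = inter_in d F"
    and X: "finite X" "X \<subseteq> carrier_vec d" "card X \<le> 2 ^ D"
    and free: "biclique_free t (incidence_graph X Q)"
  shows "card (edges (incidence_graph X Q))
    \<le> card H ^ (2 * card H) * (t * (card X + card Q) * (D + 1) ^ (2 * min d (card H)))"
proof -
  let ?s = "card H" and ?E = "{(x, q) \<in> X \<times> Q. x \<in> q}"
  have s: "1 \<le> ?s"
    using H by (simp add: Suc_leI card_gt_0_iff)
  obtain a b where a: "\<forall>h\<in>H. a h \<in> carrier_vec d"
    and ab: "\<forall>x\<in>X. \<forall>q\<in>Q. x \<in> q \<longleftrightarrow> (\<forall>h\<in>H. a h \<bullet> x \<le> (b h q :: real))"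
    using polytope_thresholds[OF X(1,2) H(3) Q(2)] by blast
  have free': "no_biclique t ?E"
    by (rule no_biclique_incidences[OF free t])
  have "card ?E \<le> ?s ^ (2 * ?s) * (t * (card X + card Q) * (D + 1) ^ (2 * min d ?s))"
  proof (cases "d < ?s")
    case True
    have E: "?E = linear_dominance X Q [] (\<lambda>x j. x $ j) d H (\<lambda>h j. a h $ j) b"
      using ab a X(2)
      by (auto simp: linear_dominance_def dominance_def scalar_prod_def atLeast0LessThan)
    have "card ?E \<le> ?s ^ (2 * d) * (t * (card X + card Q) * (D + 1) ^ (2 * d))"
      using card_linear_dominance_le[of X Q H t D "[]" "\<lambda>x j. x $ j" d "\<lambda>h j. a h $ j" b]
        free' X Q H t unfolding E by simp
    also have "\<dots> \<le> ?s ^ (2 * ?s) * (t * (card X + card Q) * (D + 1) ^ (2 * d))"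
      using True s by (intro mult_le_mono power_increasing) auto
    finally show ?thesis
      using True by simp
  next
    case False
    obtain hs where hs: "set hs = H" "length hs = ?s"
      using finite_distinct_list[OF H(1)] distinct_card by metis
    have E: "?E = dominance X Q (map (\<lambda>h. (\<lambda>x. a h \<bullet> x, b h)) hs)"
      using ab by (auto simp: dominance_def hs)
    have "card ?E \<le> 1 * (t * (card X + card Q) * (D + 1) ^ ?s)"
      using card_dominance_le[of X Q t D "map (\<lambda>h. (\<lambda>x. a h \<bullet> x, b h)) hs"] free' X Q t
      unfolding E by (simp add: hs)
    also have "\<dots> \<le> ?s ^ (2 * ?s) * (t * (card X + card Q) * (D + 1) ^ (2 * ?s))"
      using s by (intro mult_le_mono power_increasing) auto
    finally show ?thesis
      using False by simp
  qed
  then show ?thesis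
    by (simp add: card_edges_incidence_graph)
qed

theorem theorem1p7:
  "\<exists>c::real. c > 0 \<and>
     (\<forall>s::nat. s \<ge> 1 \<longrightarrow>
        (\<exists>C::real. C > 0 \<and>
           (\<forall>(d::nat) (t::nat) (n::nat) (H::real vec set set) (Q::real vec set set) (X::real vec set).
              d \<ge> 1 \<longrightarrow> t \<ge> 1 \<longrightarrow> n \<ge> 3 \<longrightarrow>
              finite H \<longrightarrow> card H = s \<longrightarrow> (\<forall>h\<in>H. half_space d h) \<longrightarrow>
              finite Q \<longrightarrow> card Q = n \<longrightarrow>
              (\<forall>q\<in>Q. polytope_in d q \<and> (\<exists>F. F \<subseteq> translates d H \<and> q = inter_in d F)) \<longrightarrow>
              finite X \<longrightarrow> card X = n \<longrightarrow> X \<subseteq> carrier_vec d \<longrightarrow>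
              biclique_free t (incidence_graph X Q) \<longrightarrow>
              real (card (edges (incidence_graph X Q)))
                \<le> C * real t * real n * ln (real n) powr (c * real d))))"
proof (rule exI[of _ 2], intro conjI allI impI)
  fix s :: nat assume s: "s \<ge> 1"
  \<comment> \<open>The factors come from \<open>card X + card Q = 2 * n\<close>, from the choices
    in the elimination, and from \<open>D + 1 \<le> 4 * ln n\<close>.\<close>
  let ?C = "2 * real s ^ (2 * s) * 4 ^ (2 * s)"
  show "\<exists>C::real. C > 0 \<and>
           (\<forall>(d::nat) (t::nat) (n::nat) (H::real vec set set) (Q::real vec set set) (X::real vec set).
              d \<ge> 1 \<longrightarrow> t \<ge> 1 \<longrightarrow> n \<ge> 3 \<longrightarrow>
              finite H \<longrightarrow> card H = s \<longrightarrow> (\<forall>h\<in>H. half_space d h) \<longrightarrow>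
              finite Q \<longrightarrow> card Q = n \<longrightarrow>
              (\<forall>q\<in>Q. polytope_in d q \<and> (\<exists>F. F \<subseteq> translates d H \<and> q = inter_in d F)) \<longrightarrow>
              finite X \<longrightarrow> card X = n \<longrightarrow> X \<subseteq> carrier_vec d \<longrightarrow>
              biclique_free t (incidence_graph X Q) \<longrightarrow>
              real (card (edges (incidence_graph X Q)))
                \<le> C * real t * real n * ln (real n) powr (2 * real d))"
  proof (intro exI[of _ ?C] conjI allI impI)
    show "0 < ?C"
      using s by simp
    fix d t n :: nat and H Q :: "real vec set set" and X :: "real vec set"
    assume "d \<ge> 1" and t: "t \<ge> 1" and n: "n \<ge> 3"
      and H: "finite H" "card H = s" "\<forall>h\<in>H. half_space d h"
      and Q: "finite Q" "card Q = n"
        "\<forall>q\<in>Q. polytope_in d q \<and> (\<exists>F. F \<subseteq> translates d H \<and> q = inter_in d F)"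
      and X: "finite X" "card X = n" "X \<subseteq> carrier_vec d"
      and free: "biclique_free t (incidence_graph X Q)"
    obtain D where D: "n \<le> 2 ^ D" "real (D + 1) \<le> 4 * ln (real n)"
      using dyadic_exponent[OF n] by blast
    have ln: "1 \<le> ln (real n)"
      by (rule ln_ge_one[OF n])
    let ?k = "2 * min d s"
    have "card (edges (incidence_graph X Q)) \<le> s ^ (2 * s) * (t * (n + n) * (D + 1) ^ ?k)"
      using card_incidences_le[OF t H(1) _ _ Q(1) _ X(1,3), of D] H Q X D(1) free s by force
    then have "real (card (edges (incidence_graph X Q)))
        \<le> real (s ^ (2 * s) * (t * (n + n) * (D + 1) ^ ?k))"
      by (rule of_nat_mono)
    also have "\<dots> = 2 * real s ^ (2 * s) * real t * real n * real (D + 1) ^ ?k"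
      by simp
    also have "\<dots> \<le> 2 * real s ^ (2 * s) * real t * real n * (4 * ln (real n)) ^ ?k"
      using D(2) by (intro mult_left_mono power_mono) auto
    also have "\<dots> = 2 * real s ^ (2 * s) * real t * real n * (4 ^ ?k * ln (real n) ^ ?k)"
      by (simp add: power_mult_distrib)
    \<comment> \<open>The minimum in \<open>?k\<close> is used twice: bounded by \<open>s\<close> it
      keeps the constant free of \<open>d\<close>, and bounded by \<open>d\<close> it gives the
      exponent \<open>2 * d\<close> of the logarithm, hence \<open>c = 2\<close>.\<close>
    also have "\<dots> \<le> 2 * real s ^ (2 * s) * real t * real n * (4 ^ (2 * s) * ln (real n) ^ (2 * d))"
      using ln by (intro mult_left_mono mult_mono power_increasing) auto
    also have "\<dots> = ?C * real t * real n * ln (real n) powr (2 * real d)"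
      using ln by (simp add: powr_realpow[symmetric])
    finally show "real (card (edges (incidence_graph X Q)))
        \<le> ?C * real t * real n * ln (real n) powr (2 * real d)" .
  qed
qed simp

end
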